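(* Let $G$ be a connected graph of order $n$ and let $\Gamma$ be a family of graphs such that $V(F)=V$ for every $F\in\Gamma$. Consider any function $h:V(G)\to\Gamma$. Then $$\kappa(G\circ_h\Gamma)=\begin{cases}(n-1)|V|+\min_{v\in V(G)}\kappa(h(v)), & \text{if } G=K_n,\ n\ge 1,\\ \kappa(G)\,|V|, & \text{if } G\neq K_n.\end{cases}$$
   Context: All graphs are finite and simple. For a graph $G$, a family of graphs $\Gamma$ and a function $h:V(G)\to\Gamma$, the product $G\circ_h\Gamma$ is the graph with vertex set $\bigcup_{a\in V(G)}\{(a,x): x\in V(h(a))\}$ in which $(a,x)(b,y)$ is an edge if and only if either $ab\in E(G)$, or $a=b$ and $xy\in E(h(a))$. The connectivity $\kappa(G)$ is the minimum size of a set of vertices whose deletion disconnects $G$ (so $\kappa=0$ for a disconnected graph), with the usual convention $\kappa(K_m)=m-1$ for complete graphs. *)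

theory Defs
  imports "Graph_Theory.Graph_Theory"
begin

text \<open>
  A finite simple graph is a \<^locale>\<open>pair_graph\<close>: a finite, loop-free digraph with symmetric arc
  set, an edge \<open>ab\<close> being the two arcs \<open>(a, b)\<close> and \<open>(b, a)\<close>.
\<close>

text \<open>
  The product \<open>G \<circ>\<^sub>h \<Gamma>\<close>. The family \<open>\<Gamma>\<close> is only the codomain of \<open>h\<close>, so it is not an argument.
\<close>

definition graph_product ::
  "'a pair_pre_digraph \<Rightarrow> ('a \<Rightarrow> 'b pair_pre_digraph) \<Rightarrow> ('a \<times> 'b) pair_pre_digraph" where
  "graph_product G h =
    \<lparr> pverts = (SIGMA a:pverts G. pverts (h a)),
      parcs = {((a, x), (b, y)) | a x b y.
        (a, x) \<in> (SIGMA a:pverts G. pverts (h a)) \<and>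
        (b, y) \<in> (SIGMA a:pverts G. pverts (h a)) \<and>
        ((a, b) \<in> parcs G \<or> a = b \<and> (x, y) \<in> parcs (h a))} \<rparr>"

text \<open>
  The subset is proper because \<^const>\<open>connected\<close> is false of the null graph: deleting every vertex
  does not count as disconnecting.
\<close>

definition disconnecting_set :: "('a, 'b) pre_digraph \<Rightarrow> 'a set \<Rightarrow> bool" where
  "disconnecting_set G S \<longleftrightarrow> S \<subset> verts G \<and> \<not> connected (G \<restriction> (verts G - S))"

text \<open>
  A non-complete graph always has a disconnecting set (all vertices but two non-adjacent ones), so
  the \<open>LEAST\<close> is attained. The null graph counts as complete and gets the value \<open>0 - 1 = 0\<close>.
\<close>

definition connectivity :: "('a, 'b) pre_digraph \<Rightarrow> nat" (\<open>\<kappa>\<close>) where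
  "\<kappa> G = (if K\<^bsub>card (verts G)\<^esub> G then card (verts G) - 1
          else (LEAST k. \<exists>S. disconnecting_set G S \<and> card S = k))"

lemma pair_graph_graph_product:
  assumes "pair_graph G" and "\<And>a. a \<in> pverts G \<Longrightarrow> pair_graph (h a)"
  shows "pair_graph (graph_product G h)"
proof -
  interpret G: pair_graph G by fact
  let ?P = "graph_product G h"
  have fin: "finite (pverts (h a))" if "a \<in> pverts G" for a
    using assms(2)[OF that] by (simp add: pair_graph_def pair_digraph_def pair_fin_digraph_def
        pair_fin_digraph_axioms_def)
  have hsym: "(y, x) \<in> parcs (h a)" if "a \<in> pverts G" "(x, y) \<in> parcs (h a)" for a x y
  proof -
    interpret H: pair_graph "h a" by (rule assms(2)[OF that(1)])
    show ?thesis using H.pair_sym_arcs that(2) unfolding symmetric_def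
      by (simp add: symD)
  qed
  have hloop: "(x, x) \<notin> parcs (h a)" if "a \<in> pverts G" for a x
  proof -
    interpret H: pair_graph "h a" by (rule assms(2)[OF that])
    show ?thesis using H.pair_no_loops[of "(x, x)"] by simp blast
  qed
  have gsym: "(b, a) \<in> parcs G" if "(a, b) \<in> parcs G" for a b
    using G.pair_sym_arcs that unfolding symmetric_def by (simp add: symD)
  have gloop: "(a, a) \<notin> parcs G" for a
    using G.pair_no_loops[of "(a, a)"] by simp blast
  have V: "finite (pverts ?P)"
    using fin G.pair_finite_verts by (simp add: graph_product_def)
  have sub: "parcs ?P \<subseteq> pverts ?P \<times> pverts ?P" by (auto simp: graph_product_def)
  have A: "finite (parcs ?P)" by (rule finite_subset[OF sub]) (simp add: V)
  have loop: "fst e \<noteq> snd e" if "e \<in> parcs ?P" for e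
    using that by (auto simp: graph_product_def gloop hloop)
  have "sym (parcs ?P)"
    by (rule symI) (auto simp: graph_product_def intro: gsym hsym)
  then have S: "symmetric (with_proj ?P)"
    unfolding symmetric_def by simp
  show ?thesis
    by unfold_locales (use V A loop S sub in auto)
qed

end

theory Submission
  imports Defs
begin

text \<open>
  Think of a disconnecting set through its complement \<open>T\<close>, a nonempty set of vertices inducing a
  disconnected subgraph. If \<open>T\<close> meets at least two fibres of the product, then \<open>T\<close> is connected
  iff its projection to \<open>G\<close> is; so a largest disconnected \<open>T\<close> with disconnected projection
  is the full preimage of a largest disconnected set of vertices of \<open>G\<close>. The only other
  disconnected sets lie in a single fibre, where they are disconnected sets of the factor. In a
  complete \<open>G\<close> only the second kind exists; in a non-complete \<open>G\<close> the second kind has at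
  most \<open>card V\<close> elements and loses against the preimage of two non-adjacent vertices.
\<close>

text \<open>
  For a symmetric arc set, connectedness amounts to every nonempty neighbour-closed subset being
  everything; in this form no walks have to be lifted to or projected from the product.
\<close>

definition connected_in :: "'a pair_pre_digraph \<Rightarrow> 'a set \<Rightarrow> bool" where
  "connected_in H T \<longleftrightarrow> T \<noteq> {} \<and>
    (\<forall>B \<subseteq> T. B \<noteq> {} \<longrightarrow> (\<forall>x\<in>B. \<forall>y\<in>T. (x, y) \<in> parcs H \<longrightarrow> y \<in> B) \<longrightarrow> B = T)"

lemma connected_inI:
  assumes "T \<noteq> {}"
    and "\<And>B. B \<subseteq> T \<Longrightarrow> B \<noteq> {} \<Longrightarrow>
      (\<And>x y. x \<in> B \<Longrightarrow> y \<in> T \<Longrightarrow> (x, y) \<in> parcs H \<Longrightarrow> y \<in> B) \<Longrightarrow> T \<subseteq> B"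
  shows "connected_in H T"
  unfolding connected_in_def using assms by (metis subset_antisym)

lemma connected_inD:
  assumes "connected_in H T" "B \<subseteq> T" "B \<noteq> {}"
    and "\<And>x y. x \<in> B \<Longrightarrow> y \<in> T \<Longrightarrow> (x, y) \<in> parcs H \<Longrightarrow> y \<in> B"
  shows "B = T"
  using assms unfolding connected_in_def by blast

lemma connected_in_nonempty: "connected_in H T \<Longrightarrow> T \<noteq> {}"
  by (simp add: connected_in_def)

text \<open>Without such a neighbour, \<open>{a}\<close> would be a nonempty closed proper subset of
  \<open>T\<close>.\<close>

lemma connected_in_neighbour:
  assumes "connected_in H T" "a \<in> T" "T \<noteq> {a}"
  obtains b where "b \<in> T" "(a, b) \<in> parcs H"
  using connected_inD[of H T "{a}"] assms by auto

lemma connected_in_complete: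
  assumes "T \<noteq> {}" and "\<And>x y. x \<in> T \<Longrightarrow> y \<in> T \<Longrightarrow> x \<noteq> y \<Longrightarrow> (x, y) \<in> parcs H"
  shows "connected_in H T"
  using assms by (intro connected_inI) blast+

section \<open>Connectedness and connectivity of a single graph via
  \<open>connected_in\<close>\<close>

context pair_graph
begin

lemma parcs_sym: "(x, y) \<in> parcs G \<Longrightarrow> (y, x) \<in> parcs G"
  using pair_sym_arcs by (auto simp: symmetric_def dest: symD)

lemma parcs_irrefl: "(x, x) \<notin> parcs G"
  using pair_no_loops[of "(x, x)"] by auto

lemma connected_induce_iff: "connected (with_proj G \<restriction> T) \<longleftrightarrow> connected_in G T"
proof -
  define E where "E = parcs G \<inter> T \<times> T"
  have ends: "arcs_ends (with_proj G \<restriction> T) = E"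
    by (force simp: E_def arcs_ends_conv induce_subgraph_def)
  have "E\<^sup>s = E"
    by (auto simp: E_def symcl_def dest: parcs_sym)
  \<comment> \<open>The library's \<open>connected\<close> refers to reachability in the symmetric
    closure of the arcs, which is \<open>E\<close> itself here.\<close>
  then have conv: "connected (with_proj G \<restriction> T) \<longleftrightarrow>
      T \<noteq> {} \<and> (\<forall>u\<in>T. \<forall>v\<in>T. (u, v) \<in> rtrancl_on T E)"
    by (simp add: connected_conv ends)
  show ?thesis
  proof
    assume con: "connected (with_proj G \<restriction> T)"
    show "connected_in G T"
    proof (rule connected_inI)
      show "T \<noteq> {}" using con conv by blast
      fix B
      assume B: "B \<subseteq> T" "B \<noteq> {}"
        and closed: "\<And>x y. x \<in> B \<Longrightarrow> y \<in> T \<Longrightarrow> (x, y) \<in> parcs G \<Longrightarrow> y \<in> B"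
      then obtain u where u: "u \<in> B" by blast
      show "T \<subseteq> B"
      proof
        fix v assume "v \<in> T"
        with u B con conv have "(u, v) \<in> rtrancl_on T E" by blast
        then show "v \<in> B"
          by (induction rule: rtrancl_on_induct) (use u closed in \<open>auto simp: E_def\<close>)
      qed
    qed
  next
    assume con: "connected_in G T"
    have "(u, v) \<in> rtrancl_on T E" if "u \<in> T" "v \<in> T" for u v
    proof -
      \<comment> \<open>The vertices reachable from \<open>u\<close> form a closed set containing
        \<open>u\<close>.\<close>
      have "{w \<in> T. (u, w) \<in> rtrancl_on T E} = T"
      proof (rule connected_inD[OF con])
        show "{w \<in> T. (u, w) \<in> rtrancl_on T E} \<noteq> {}" using \<open>u \<in> T\<close> by auto
      qed (auto simp: E_def intro: rtrancl_on_into_rtrancl_on)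
      with \<open>v \<in> T\<close> show ?thesis by blast
    qed
    then show "connected (with_proj G \<restriction> T)"
      using connected_in_nonempty[OF con] conv by blast
  qed
qed

text \<open>\<open>complete_digraph\<close> demands equality of arc sets; one inclusion is automatic
  since arcs join distinct vertices.\<close>

lemma complete_iff:
  "K\<^bsub>card (pverts G)\<^esub> (with_proj G) \<longleftrightarrow>
    (\<forall>x\<in>pverts G. \<forall>y\<in>pverts G. x \<noteq> y \<longrightarrow> (x, y) \<in> parcs G)"
proof -
  have gr: "graph (with_proj G)" by intro_locales
  have sub: "x \<in> pverts G" "y \<in> pverts G" "x \<noteq> y" if "(x, y) \<in> parcs G" for x y
    using in_arcsD1[OF that] in_arcsD2[OF that] parcs_irrefl[of y] that by auto
  have "parcs G = {(u, v). (u, v) \<in> pverts G \<times> pverts G \<and> u \<noteq> v} \<longleftrightarrow>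
      (\<forall>x\<in>pverts G. \<forall>y\<in>pverts G. x \<noteq> y \<longrightarrow> (x, y) \<in> parcs G)"
    by (auto simp: set_eq_iff dest: sub)
  with gr show ?thesis
    by (simp add: complete_digraph_def)
qed

text \<open>Passage to complements: that a disconnecting set is proper becomes
  \<open>T \<noteq> {}\<close>.\<close>

lemma disconnecting_set_Diff:
  assumes "T \<subseteq> pverts G"
  shows "disconnecting_set G (pverts G - T) \<longleftrightarrow> T \<noteq> {} \<and> \<not> connected_in G T"
proof -
  have "pverts G - (pverts G - T) = T" using assms by blast
  then show ?thesis using assms
    by (simp add: disconnecting_set_def connected_induce_iff psubset_eq) blast
qed

lemma connectivity_complete:
  assumes "K\<^bsub>card (pverts G)\<^esub> (with_proj G)"
  shows "\<kappa> G = card (pverts G) - 1"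
  using assms by (simp add: connectivity_def)

text \<open>The set \<open>T\<close> rules out completeness, so \<open>\<kappa> G\<close> is the
  \<open>LEAST\<close> value. The additive form avoids truncated subtraction.\<close>

lemma connectivity_le:
  assumes "T \<subseteq> pverts G" "T \<noteq> {}" "\<not> connected_in G T"
  shows "\<kappa> G + card T \<le> card (pverts G)"
proof -
  have "\<not> K\<^bsub>card (pverts G)\<^esub> (with_proj G)"
    using assms connected_in_complete[of T G] unfolding complete_iff by blast
  then have "\<kappa> G = (LEAST k. \<exists>S. disconnecting_set G S \<and> card S = k)"
    by (simp add: connectivity_def)
  moreover have "disconnecting_set G (pverts G - T)"
    using assms by (simp add: disconnecting_set_Diff)
  ultimately have "\<kappa> G \<le> card (pverts G - T)"
    by (auto intro: Least_le)
  also have "\<dots> = card (pverts G) - card T"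
    using assms by (simp add: card_Diff_subset finite_subset[OF _ pair_finite_verts])
  finally show ?thesis
    using card_mono[OF pair_finite_verts assms(1)] by simp
qed

text \<open>Two non-adjacent vertices show that the \<open>LEAST\<close> ranges over a nonempty set;
  a minimiser is then complemented.\<close>

lemma connectivity_attained:
  assumes "\<not> K\<^bsub>card (pverts G)\<^esub> (with_proj G)"
  obtains T where "T \<subseteq> pverts G" "T \<noteq> {}" "\<not> connected_in G T"
    "\<kappa> G + card T = card (pverts G)"
proof -
  obtain a b where ab: "a \<in> pverts G" "b \<in> pverts G" "a \<noteq> b" "(a, b) \<notin> parcs G"
    using assms unfolding complete_iff by blast
  have "\<not> connected_in G {a, b}"
  proof
    assume "connected_in G {a, b}"
    then have "{a} = {a, b}" by (rule connected_inD) (use ab in auto)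
    with ab show False by blast
  qed
  then have "disconnecting_set G (pverts G - {a, b})"
    using ab by (simp add: disconnecting_set_Diff)
  then have "\<exists>k S. disconnecting_set G S \<and> card S = k" by blast
  from LeastI_ex[OF this] have "\<exists>S. disconnecting_set G S \<and> card S = \<kappa> G"
    using assms by (simp only: connectivity_def with_proj_simps if_False)
  then obtain S where S: "disconnecting_set G S" "card S = \<kappa> G" by blast
  have sub: "S \<subseteq> pverts G" using S by (auto simp: disconnecting_set_def)
  then have "pverts G - (pverts G - S) = S" by blast
  with S have "pverts G - S \<noteq> {}" "\<not> connected_in G (pverts G - S)"
    using disconnecting_set_Diff[of "pverts G - S"] by simp_all
  moreover have "\<kappa> G + card (pverts G - S) = card (pverts G)"
    using sub S card_mono[OF pair_finite_verts sub]
    by (simp add: card_Diff_subset finite_subset[OF _ pair_finite_verts])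
  ultimately show thesis by (intro that[of "pverts G - S"]) simp_all
qed

lemma connectivity_less:
  assumes "pverts G \<noteq> {}"
  shows "\<kappa> G + 1 \<le> card (pverts G)"
proof (cases "K\<^bsub>card (pverts G)\<^esub> (with_proj G)")
  case True
  moreover have "card (pverts G) > 0" using assms pair_finite_verts by (simp add: card_gt_0_iff)
  ultimately show ?thesis by (simp add: connectivity_complete)
next
  case False
  then obtain T where T: "T \<subseteq> pverts G" "T \<noteq> {}" "\<not> connected_in G T"
      "\<kappa> G + card T = card (pverts G)"
    by (rule connectivity_attained)
  then have "card T > 0" using finite_subset[OF _ pair_finite_verts] by (simp add: card_gt_0_iff)
  with T show ?thesis by simp
qed

end

section \<open>The product and connectedness of its vertex sets\<close>

locale fibred_graph = pair_graph G for G :: "'a pair_pre_digraph" +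
  fixes h :: "'a \<Rightarrow> 'b pair_pre_digraph" and V :: "'b set"
  assumes fibre: "a \<in> pverts G \<Longrightarrow> pair_graph (h a)"
    and pverts_fibre: "a \<in> pverts G \<Longrightarrow> pverts (h a) = V"
begin

sublocale product: pair_graph "graph_product G h"
  by (intro pair_graph_graph_product fibre) unfold_locales

lemma pverts_product: "pverts (graph_product G h) = pverts G \<times> V"
  by (auto simp: graph_product_def pverts_fibre)

lemma parcs_product:
  "((a, x), (b, y)) \<in> parcs (graph_product G h) \<longleftrightarrow>
    a \<in> pverts G \<and> b \<in> pverts G \<and> x \<in> V \<and> y \<in> V \<and> ((a, b) \<in> parcs G \<or> a = b \<and> (x, y) \<in> parcs (h a))"
  by (auto simp: graph_product_def pverts_fibre)

text \<open>Since \<open>G\<close> has no loops, two vertices over \<open>a\<close> are adjacent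
  only through an arc of \<open>h a\<close>, so the fibre is a copy of \<open>h a\<close>.\<close>

lemma connected_in_fibre_iff:
  assumes "a \<in> pverts G" "U \<subseteq> V"
  shows "connected_in (graph_product G h) ({a} \<times> U) \<longleftrightarrow> connected_in (h a) U"
proof
  assume con: "connected_in (graph_product G h) ({a} \<times> U)"
  show "connected_in (h a) U"
  proof (rule connected_inI)
    show "U \<noteq> {}" using connected_in_nonempty[OF con] by blast
    fix B
    assume B: "B \<subseteq> U" "B \<noteq> {}"
      and closed: "\<And>x y. x \<in> B \<Longrightarrow> y \<in> U \<Longrightarrow> (x, y) \<in> parcs (h a) \<Longrightarrow> y \<in> B"
    have "{a} \<times> B = {a} \<times> U"
      by (rule connected_inD[OF con]) (use B closed parcs_irrefl in \<open>auto simp: parcs_product\<close>)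
    then show "U \<subseteq> B" by blast
  qed
next
  assume con: "connected_in (h a) U"
  show "connected_in (graph_product G h) ({a} \<times> U)"
  proof (rule connected_inI)
    show "{a} \<times> U \<noteq> {}" using connected_in_nonempty[OF con] by blast
    fix B
    assume B: "B \<subseteq> {a} \<times> U" "B \<noteq> {}"
      and closed: "\<And>p q. p \<in> B \<Longrightarrow> q \<in> {a} \<times> U \<Longrightarrow> (p, q) \<in> parcs (graph_product G h) \<Longrightarrow> q \<in> B"
    have "snd ` B = U"
    proof (rule connected_inD[OF con])
      fix x y assume "x \<in> snd ` B" "y \<in> U" "(x, y) \<in> parcs (h a)"
      moreover from this B have "(a, x) \<in> B" "x \<in> U" by auto
      ultimately have "(a, y) \<in> B"
        using closed[of "(a, x)" "(a, y)"] assms by (auto simp: parcs_product)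
      then show "y \<in> snd ` B" by force
    qed (use B in auto)
    then show "{a} \<times> U \<subseteq> B" using B by auto
  qed
qed

text \<open>An arc of the product projects to an arc or to a single vertex, so the part of
  \<open>T\<close> lying over a closed set is closed.\<close>

lemma connected_in_fst_image:
  assumes con: "connected_in (graph_product G h) T" and sub: "T \<subseteq> pverts G \<times> V"
  shows "connected_in G (fst ` T)"
proof (rule connected_inI)
  show "fst ` T \<noteq> {}" using connected_in_nonempty[OF con] by blast
  fix B
  assume B: "B \<subseteq> fst ` T" "B \<noteq> {}"
    and closed: "\<And>x y. x \<in> B \<Longrightarrow> y \<in> fst ` T \<Longrightarrow> (x, y) \<in> parcs G \<Longrightarrow> y \<in> B"
  have "{p \<in> T. fst p \<in> B} = T"
  proof (rule connected_inD[OF con])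
    fix p q assume "p \<in> {p \<in> T. fst p \<in> B}" "q \<in> T" "(p, q) \<in> parcs (graph_product G h)"
    then show "q \<in> {p \<in> T. fst p \<in> B}"
      using closed[of "fst p" "fst q"] by (cases p; cases q) (force simp: parcs_product)
  next
    show "{p \<in> T. fst p \<in> B} \<noteq> {}" using B by blast
  qed blast
  then show "fst ` T \<subseteq> B" by blast
qed

text \<open>
  Two vertices of the same fibre are joined through any neighbouring fibre, so the arcs inside the
  fibres are irrelevant here.
\<close>

lemma connected_in_if_fst_image:
  assumes sub: "T \<subseteq> pverts G \<times> V"
    and con: "connected_in G (fst ` T)" and two: "\<And>a. fst ` T \<noteq> {a}"
  shows "connected_in (graph_product G h) T"
proof (rule connected_inI)
  show "T \<noteq> {}" using connected_in_nonempty[OF con] by blast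
  fix B
  assume B: "B \<subseteq> T" "B \<noteq> {}"
    and closed: "\<And>p q. p \<in> B \<Longrightarrow> q \<in> T \<Longrightarrow> (p, q) \<in> parcs (graph_product G h) \<Longrightarrow> q \<in> B"
  have step: "q \<in> B" if "p \<in> B" "q \<in> T" "(fst p, fst q) \<in> parcs G" for p q
  proof (rule closed[OF that(1,2)])
    have "p \<in> pverts G \<times> V" "q \<in> pverts G \<times> V" using that B sub by auto
    with that(3) show "(p, q) \<in> parcs (graph_product G h)"
      by (cases p; cases q) (simp add: parcs_product)
  qed
  have all: "fst ` B = fst ` T"
  proof (rule connected_inD[OF con])
    fix a b assume "a \<in> fst ` B" "b \<in> fst ` T" "(a, b) \<in> parcs G"
    then show "b \<in> fst ` B" using step by force
  qed (use B in auto)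
  show "T \<subseteq> B"
  proof
    fix q assume "q \<in> T"
    then obtain b where "b \<in> fst ` T" "(fst q, b) \<in> parcs G"
      using connected_in_neighbour[OF con _ two] by blast
    then obtain p where "p \<in> B" "fst p = b" using all by (metis imageE)
    then show "q \<in> B" using step \<open>q \<in> T\<close> parcs_sym \<open>(fst q, b) \<in> parcs G\<close> by blast
  qed
qed

lemma disconnected_cases:
  assumes "T \<subseteq> pverts G \<times> V" "T \<noteq> {}" "\<not> connected_in (graph_product G h) T"
  obtains (projection) "\<not> connected_in G (fst ` T)"
  | (single_fibre) a U where "a \<in> pverts G" "U \<subseteq> V" "T = {a} \<times> U" "U \<noteq> {}" "\<not> connected_in (h a) U"
proof (cases "\<exists>a. fst ` T = {a}")
  case True
  then obtain a where a: "fst ` T = {a}" by blast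
  then have T: "T = {a} \<times> snd ` T" by force
  moreover have "a \<in> pverts G" "snd ` T \<subseteq> V" using a assms(1) by force+
  ultimately show thesis
    using assms connected_in_fibre_iff[of a "snd ` T"] single_fibre[of a "snd ` T"] by auto
next
  case False
  then show thesis using projection assms connected_in_if_fst_image by blast
qed

text \<open>For empty \<open>V\<close> the product is the null graph, which counts as complete
  whatever \<open>G\<close> is; hence \<open>V \<noteq> {}\<close>.\<close>

lemma product_complete_iff:
  assumes "V \<noteq> {}"
  shows "K\<^bsub>card (pverts (graph_product G h))\<^esub> (with_proj (graph_product G h)) \<longleftrightarrow>
    K\<^bsub>card (pverts G)\<^esub> (with_proj G) \<and> (\<forall>a\<in>pverts G. K\<^bsub>card (pverts (h a))\<^esub> (with_proj (h a)))"
proof -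
  have "K\<^bsub>card (pverts (h a))\<^esub> (with_proj (h a)) \<longleftrightarrow>
      (\<forall>x\<in>V. \<forall>y\<in>V. x \<noteq> y \<longrightarrow> (x, y) \<in> parcs (h a))" if "a \<in> pverts G" for a
    using pair_graph.complete_iff[OF fibre[OF that]] pverts_fibre[OF that] by simp
  then have fibres: "(\<forall>a\<in>pverts G. K\<^bsub>card (pverts (h a))\<^esub> (with_proj (h a))) \<longleftrightarrow>
      (\<forall>a\<in>pverts G. \<forall>x\<in>V. \<forall>y\<in>V. x \<noteq> y \<longrightarrow> (x, y) \<in> parcs (h a))"
    by (intro ball_cong refl)
  have "(\<forall>p\<in>pverts G \<times> V. \<forall>q\<in>pverts G \<times> V. p \<noteq> q \<longrightarrow> (p, q) \<in> parcs (graph_product G h)) \<longleftrightarrow>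
      (\<forall>a\<in>pverts G. \<forall>b\<in>pverts G. a \<noteq> b \<longrightarrow> (a, b) \<in> parcs G) \<and>
      (\<forall>a\<in>pverts G. \<forall>x\<in>V. \<forall>y\<in>V. x \<noteq> y \<longrightarrow> (x, y) \<in> parcs (h a))" (is "?P \<longleftrightarrow> ?A \<and> ?B")
  proof (intro iffI conjI ballI impI)
    fix a b assume P: ?P and ab: "a \<in> pverts G" "b \<in> pverts G" "a \<noteq> b"
    obtain z where "z \<in> V" using assms by blast
    with P ab have "((a, z), (b, z)) \<in> parcs (graph_product G h)" by blast
    with ab show "(a, b) \<in> parcs G" by (simp add: parcs_product)
  next
    fix a x y assume P: ?P and axy: "a \<in> pverts G" "x \<in> V" "y \<in> V" "x \<noteq> y"
    then have "((a, x), (a, y)) \<in> parcs (graph_product G h)" by blast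
    then show "(x, y) \<in> parcs (h a)" using parcs_irrefl by (simp add: parcs_product)
  next
    fix p q assume AB: "?A \<and> ?B" and pq: "p \<in> pverts G \<times> V" "q \<in> pverts G \<times> V" "p \<noteq> q"
    obtain a x b y where [simp]: "p = (a, x)" "q = (b, y)" by (metis surj_pair)
    show "(p, q) \<in> parcs (graph_product G h)"
      using AB pq by (cases "a = b") (simp_all add: parcs_product)
  qed
  then show ?thesis
    unfolding product.complete_iff complete_iff fibres unfolding pverts_product .
qed

section \<open>The connectivity of the product\<close>

lemma finite_fibre:
  assumes "pverts G \<noteq> {}"
  shows "finite V"
proof -
  obtain a where a: "a \<in> pverts G" using assms by blast
  interpret H: pair_graph "h a" using a by (rule fibre)
  show ?thesis using H.pair_finite_verts pverts_fibre[OF a] by simp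
qed

lemma connectivity_product_noncomplete:
  assumes nc: "\<not> K\<^bsub>card (pverts G)\<^esub> (with_proj G)" and V: "V \<noteq> {}"
  shows "\<kappa> (graph_product G h) = \<kappa> G * card V"
proof (rule antisym)
  obtain A where A: "A \<subseteq> pverts G" "A \<noteq> {}" "\<not> connected_in G A" "\<kappa> G + card A = card (pverts G)"
    using connectivity_attained[OF nc] .
  then have finV: "finite V" by (intro finite_fibre) auto
  \<comment> \<open>As \<open>V\<close> is nonempty, the projection of \<open>A \<times> V\<close>
    is all of \<open>A\<close>.\<close>
  have "\<not> connected_in (graph_product G h) (A \<times> V)"
    using connected_in_fst_image[of "A \<times> V"] A V by auto
  then have "\<kappa> (graph_product G h) + card (A \<times> V) \<le> card (pverts G \<times> V)"
    using product.connectivity_le[of "A \<times> V"] A V by (auto simp: pverts_product)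
  \<comment> \<open>Replacing \<open>card (pverts G)\<close> by \<open>\<kappa> G + card A\<close>
    makes the summand \<open>card A * card V\<close> cancel.\<close>
  then show "\<kappa> (graph_product G h) \<le> \<kappa> G * card V"
    by (simp add: card_cartesian_product flip: A(4)) (simp add: algebra_simps)
  have "\<not> K\<^bsub>card (pverts (graph_product G h))\<^esub> (with_proj (graph_product G h))"
    using nc product_complete_iff[OF V] by blast
  then obtain T where T: "T \<subseteq> pverts G \<times> V" "T \<noteq> {}" "\<not> connected_in (graph_product G h) T"
    and card: "\<kappa> (graph_product G h) + card T = card (pverts G) * card V"
    using product.connectivity_attained
    unfolding pverts_product card_cartesian_product by metis
  obtain c where c: "\<kappa> G + c \<le> card (pverts G)" "card T \<le> c * card V"
    using T
  proof (cases rule: disconnected_cases)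
    case projection
    have "T \<subseteq> fst ` T \<times> V" using T by force
    moreover have "fst ` T \<subseteq> pverts G" using T by auto
    ultimately have "card T \<le> card (fst ` T \<times> V)"
      using finV finite_subset[OF _ pair_finite_verts]
      by (intro card_mono finite_cartesian_product) blast+
    moreover have "\<kappa> G + card (fst ` T) \<le> card (pverts G)"
      using T projection by (intro connectivity_le) auto
    ultimately show thesis using that[of "card (fst ` T)"] by (simp add: card_cartesian_product)
  next
    case (single_fibre a U)
    then have "card T \<le> card {a} * card V"
      using card_mono[OF finV, of U] by (simp add: card_cartesian_product)
    \<comment> \<open>A single fibre obeys the same bound because deleting \<open>\<kappa> G\<close>
      vertices always leaves at least one.\<close>
    moreover have "\<kappa> G + card {a} \<le> card (pverts G)"
      using connectivity_less single_fibre(1) by auto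
    ultimately show thesis using that by blast
  qed
  have "\<kappa> G * card V + c * card V \<le> card (pverts G) * card V"
    using c(1) by (metis add_mult_distrib mult_le_mono1)
  with card c(2) show "\<kappa> G * card V \<le> \<kappa> (graph_product G h)" by linarith
qed

lemma connectivity_product_complete:
  assumes com: "K\<^bsub>card (pverts G)\<^esub> (with_proj G)" and V: "V \<noteq> {}" and ne: "pverts G \<noteq> {}"
  shows "\<kappa> (graph_product G h) = (card (pverts G) - 1) * card V + (MIN v\<in>pverts G. \<kappa> (h v))"
proof -
  have finV: "finite V" using ne by (rule finite_fibre)
  define m where "m = (MIN v\<in>pverts G. \<kappa> (h v))"
  have m_le: "m \<le> \<kappa> (h a)" if "a \<in> pverts G" for a
    unfolding m_def using that pair_finite_verts by (intro Min_le) auto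
  have "m \<in> (\<lambda>v. \<kappa> (h v)) ` pverts G"
    unfolding m_def using ne pair_finite_verts by (intro Min_in) auto
  then obtain c where c: "c \<in> pverts G" "\<kappa> (h c) = m" by auto
  have split: "card (pverts G) * card V = (card (pverts G) - 1) * card V + card V"
    using ne pair_finite_verts by (cases "card (pverts G)") auto
  \<comment> \<open>This makes \<open>card V\<close> positive, so that \<open>card V - 1\<close> is
    a true subtraction in the complete cases below.\<close>
  have less: "m + 1 \<le> card V"
    using pair_graph.connectivity_less[OF fibre[OF c(1)]] c V by (simp add: pverts_fibre)
  have "\<kappa> (graph_product G h) = (card (pverts G) - 1) * card V + m"
  proof (cases "K\<^bsub>card (pverts (graph_product G h))\<^esub> (with_proj (graph_product G h))")
    case True
    then have "K\<^bsub>card (pverts (h c))\<^esub> (with_proj (h c))"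
      using product_complete_iff[OF V] c by blast
    then have "m = card V - 1"
      using pair_graph.connectivity_complete[OF fibre[OF c(1)]] c by (simp add: pverts_fibre)
    then show ?thesis
      using product.connectivity_complete[OF True] split less
      by (simp add: pverts_product card_cartesian_product)
  next
    case False
    have lower: "(card (pverts G) - 1) * card V + m \<le> \<kappa> (graph_product G h)"
    proof -
      obtain T where T: "T \<subseteq> pverts G \<times> V" "T \<noteq> {}" "\<not> connected_in (graph_product G h) T"
        and card: "\<kappa> (graph_product G h) + card T = card (pverts G) * card V"
        using product.connectivity_attained[OF False]
        unfolding pverts_product card_cartesian_product by metis
      from T show ?thesis
      proof (cases rule: disconnected_cases)
        case projection
        have "fst ` T \<subseteq> pverts G" using T by auto
        \<comment> \<open>Every nonempty vertex set of a complete graph is connected, so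
          \<open>T\<close> must lie in a single fibre.\<close>
        then have "connected_in G (fst ` T)"
          using com T(2) unfolding complete_iff by (intro connected_in_complete) blast+
        with projection show ?thesis by blast
      next
        case (single_fibre a U)
        then have "\<kappa> (h a) + card T \<le> card V"
          using pair_graph.connectivity_le[OF fibre[OF single_fibre(1)], of U]
          by (simp add: pverts_fibre card_cartesian_product)
        with card split m_le[OF single_fibre(1)] show ?thesis by linarith
      qed
    qed
    have upper: "\<kappa> (graph_product G h) \<le> (card (pverts G) - 1) * card V + m"
    \<comment> \<open>If the minimising factor \<open>h c\<close> is complete, then
      \<open>m = card V - 1\<close> and the claim is the general bound by order minus one. Otherwise
      a largest disconnected set of \<open>h c\<close> is placed in the fibre over
      \<open>c\<close>.\<close>
    proof (cases "K\<^bsub>card (pverts (h c))\<^esub> (with_proj (h c))")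
      case True
      then have "m = card V - 1"
        using pair_graph.connectivity_complete[OF fibre[OF c(1)]] c by (simp add: pverts_fibre)
      moreover have "\<kappa> (graph_product G h) + 1 \<le> card (pverts G) * card V"
        using product.connectivity_less ne V by (simp add: pverts_product card_cartesian_product)
      ultimately show ?thesis using split less by linarith
    next
      case False
      then obtain U where U: "U \<subseteq> V" "U \<noteq> {}" "\<not> connected_in (h c) U" "m + card U = card V"
        using pair_graph.connectivity_attained[OF fibre[OF c(1)]] c pverts_fibre by metis
      have "\<kappa> (graph_product G h) + card ({c} \<times> U) \<le> card (pverts G \<times> V)"
        using product.connectivity_le[of "{c} \<times> U"] c U
        by (auto simp: pverts_product connected_in_fibre_iff)
      then show ?thesis using U(4) split by (simp add: card_cartesian_product)
    qed
    from lower upper show ?thesis by simp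
  qed
  then show ?thesis by (simp add: m_def)
qed

end

theorem theorem2p8:
  fixes G :: "'a pair_pre_digraph"
    and \<Gamma> :: "'b pair_pre_digraph set"
    and V :: "'b set"
    and h :: "'a \<Rightarrow> 'b pair_pre_digraph"
    and n :: nat
  assumes "pair_graph G" and "connected G" and "card (pverts G) = n"
    and "\<And>F. F \<in> \<Gamma> \<Longrightarrow> pair_graph F"
    and "\<And>F. F \<in> \<Gamma> \<Longrightarrow> pverts F = V"
    and "h \<in> pverts G \<rightarrow> \<Gamma>"
  shows "\<kappa> (graph_product G h) =
    (if K\<^bsub>n\<^esub> G then (n - 1) * card V + (MIN v\<in>pverts G. \<kappa> (h v)) else \<kappa> G * card V)"
proof -
  interpret pair_graph G by fact
  interpret fibred_graph G h V
    by (intro fibred_graph.intro fibred_graph_axioms.intro)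
      (use assms in \<open>auto simp: Pi_iff\<close>)
  \<comment> \<open>Connectedness excludes the null graph, so the minimum is over a nonempty
    set.\<close>
  have ne: "pverts G \<noteq> {}" using assms(2) by (simp add: connected_conv)
  show ?thesis
  \<comment> \<open>With \<open>V\<close> empty, the product and all factors are null graphs of
    connectivity 0, so both branches of the formula vanish.\<close>
  proof (cases "V = {}")
    case True
    have "\<kappa> (h v) = 0" if "v \<in> pverts G" for v
      using pair_graph.complete_iff[OF fibre[OF that]] pverts_fibre[OF that] True
      by (simp add: connectivity_def)
    then have "(\<lambda>v. \<kappa> (h v)) ` pverts G = {0}" using ne by auto
    moreover have "\<kappa> (graph_product G h) = 0"
      using product.complete_iff True by (simp add: connectivity_def pverts_product)
    ultimately show ?thesis using True by simp
  next
    case False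
    then show ?thesis
      using connectivity_product_complete connectivity_product_noncomplete ne assms(3) by simp
  qed
qed

end
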